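(* Let $(P,Q)$ be a harmonious quasi-projection pair on a Hilbert $C^*$-module $H$ with $P$ non-trivial, and suppose $$U_PQU_P^*=\begin{pmatrix} A & -\ell(A)U^*\\ U\ell(A) & U(I_{\mathcal{R}(P)}-A)U^*+Q_0\end{pmatrix},$$ where $A\in\mathcal{L}(\mathcal{R}(P))$ is self-adjoint with $A^2-A\ge0$, $U\in\mathcal{L}(\mathcal{R}(P),\mathcal{N}(P))$ is a partial isometry, $Q_0\in\mathcal{L}(\mathcal{N}(P))$ is a projection, $\mathcal{R}(U^* )=\overline{\mathcal{R}(A^2-A)}$ and $U^*Q_0=0$. Then the following are equivalent: (i) $\mathcal{N}(A)=\mathcal{N}(I_{\mathcal{R}(P)}-A)=\{0\}$ and $\mathcal{N}(U^* )=\{0\}$; (ii) $\mathcal{N}(A^2-A)=\{0\}$ and $\mathcal{N}(U^* )=\{0\}$; (iii) $U\in\mathcal{L}(\mathcal{R}(P),\mathcal{N}(P))$ is a unitary operator; (iv) $\mathcal{N}(A)=\mathcal{N}(I_{\mathcal{R}(P)}-A)=\{0\}$ and $\mathcal{N}(Q_{22})=\mathcal{N}(I_{\mathcal{N}(P)}-Q_{22})=\{0\}$, where $Q_{22}=U(I_{\mathcal{R}(P)}-A)U^*+Q_0$.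
   Context: $H$ is a Hilbert module over a $C^*$-algebra, $\mathcal{L}(H)$ the adjointable operators; projections are self-adjoint idempotents; $P$ non-trivial means $P\ne0,I$. A quasi-projection pair is $(P,Q)$ with $P$ a projection, $Q$ an idempotent and $Q^*=(2P-I)Q(2P-I)$; it is harmonious if $\overline{\mathcal{R}(PQ(I-P))}$ and $\overline{\mathcal{R}((I-P)QP)}$ are orthogonally complemented in $H$ (a closed submodule $M$ is orthogonally complemented if $H=M+M^\perp$). $U_P:H\to\mathcal{R}(P)\oplus\mathcal{N}(P)$ is the unitary $h\mapsto(Ph,(I-P)h)^T$, and $\ell(A)=(A^2-A)^{1/2}$. *)

theory Defs
  imports "HOL-Analysis.Analysis"
begin

definition cstar_algebra ::
  "(complex \<Rightarrow> 'a::{real_normed_algebra,banach} \<Rightarrow> 'a) \<Rightarrow> ('a \<Rightarrow> 'a) \<Rightarrow> bool" where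
  "cstar_algebra scA st \<longleftrightarrow>
     (\<forall>r a. scA (complex_of_real r) a = scaleR r a) \<and>
     (\<forall>c a b. scA c (a + b) = scA c a + scA c b) \<and>
     (\<forall>c d a. scA (c + d) a = scA c a + scA d a) \<and>
     (\<forall>c d a. scA (c * d) a = scA c (scA d a)) \<and>
     (\<forall>c a b. scA c (a * b) = scA c a * b \<and> scA c (a * b) = a * scA c b) \<and>
     (\<forall>c a. norm (scA c a) = cmod c * norm a) \<and>
     (\<forall>a b. st (a + b) = st a + st b) \<and>
     (\<forall>c a. st (scA c a) = scA (cnj c) (st a)) \<and>
     (\<forall>a b. st (a * b) = st b * st a) \<and>
     (\<forall>a. st (st a) = a) \<and>
     (\<forall>a. norm (st a * a) = (norm a)\<^sup>2)"

definition cstar_pos :: "('a::ring \<Rightarrow> 'a) \<Rightarrow> 'a \<Rightarrow> bool" where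
  "cstar_pos st a \<longleftrightarrow> (\<exists>b. a = st b * b)"

definition hnorm :: "('h \<Rightarrow> 'h \<Rightarrow> 'a::real_normed_vector) \<Rightarrow> 'h \<Rightarrow> real" where
  "hnorm ip x = sqrt (norm (ip x x))"

definition hconv :: "('h::ab_group_add \<Rightarrow> 'h \<Rightarrow> 'a::real_normed_vector) \<Rightarrow> (nat \<Rightarrow> 'h) \<Rightarrow> 'h \<Rightarrow> bool" where
  "hconv ip X L \<longleftrightarrow> (\<forall>e>0. \<exists>N. \<forall>n\<ge>N. hnorm ip (X n - L) < e)"

definition hcauchy :: "('h::ab_group_add \<Rightarrow> 'h \<Rightarrow> 'a::real_normed_vector) \<Rightarrow> (nat \<Rightarrow> 'h) \<Rightarrow> bool" where
  "hcauchy ip X \<longleftrightarrow> (\<forall>e>0. \<exists>N. \<forall>m\<ge>N. \<forall>n\<ge>N. hnorm ip (X m - X n) < e)"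

definition hilbert_cstar_module ::
  "(complex \<Rightarrow> 'a::{real_normed_algebra,banach} \<Rightarrow> 'a) \<Rightarrow> ('a \<Rightarrow> 'a) \<Rightarrow>
   (complex \<Rightarrow> 'h::ab_group_add \<Rightarrow> 'h) \<Rightarrow> ('h \<Rightarrow> 'a \<Rightarrow> 'h) \<Rightarrow> ('h \<Rightarrow> 'h \<Rightarrow> 'a) \<Rightarrow> bool" where
  "hilbert_cstar_module scA st scH act ip \<longleftrightarrow>
     cstar_algebra scA st \<and>
     (\<forall>c x y. scH c (x + y) = scH c x + scH c y) \<and>
     (\<forall>c d x. scH (c + d) x = scH c x + scH d x) \<and>
     (\<forall>c d x. scH (c * d) x = scH c (scH d x)) \<and>
     (\<forall>x. scH 1 x = x) \<and>
     (\<forall>x y a. act (x + y) a = act x a + act y a) \<and>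
     (\<forall>x a b. act x (a + b) = act x a + act x b) \<and>
     (\<forall>x a b. act x (a * b) = act (act x a) b) \<and>
     (\<forall>c x a. scH c (act x a) = act (scH c x) a \<and> scH c (act x a) = act x (scA c a)) \<and>
     (\<forall>x y z. ip x (y + z) = ip x y + ip x z) \<and>
     (\<forall>c x y. ip x (scH c y) = scA c (ip x y)) \<and>
     (\<forall>x y a. ip x (act y a) = ip x y * a) \<and>
     (\<forall>x y. st (ip x y) = ip y x) \<and>
     (\<forall>x. cstar_pos st (ip x x)) \<and>
     (\<forall>x. ip x x = 0 \<longrightarrow> x = 0) \<and>
     (\<forall>X. hcauchy ip X \<longrightarrow> (\<exists>L. hconv ip X L))"

definition adjointable :: "('h \<Rightarrow> 'h \<Rightarrow> 'a) \<Rightarrow> ('h \<Rightarrow> 'h) \<Rightarrow> bool" where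
  "adjointable ip T \<longleftrightarrow> (\<exists>S. \<forall>x y. ip (T x) y = ip x (S y))"

definition adj :: "('h \<Rightarrow> 'h \<Rightarrow> 'a) \<Rightarrow> ('h \<Rightarrow> 'h) \<Rightarrow> ('h \<Rightarrow> 'h)" where
  "adj ip T = (THE S. \<forall>x y. ip (T x) y = ip x (S y))"

definition is_projection :: "('h \<Rightarrow> 'h \<Rightarrow> 'a) \<Rightarrow> ('h \<Rightarrow> 'h) \<Rightarrow> bool" where
  "is_projection ip P \<longleftrightarrow> adjointable ip P \<and> P \<circ> P = P \<and> adj ip P = P"

definition is_idempotent :: "('h \<Rightarrow> 'h \<Rightarrow> 'a) \<Rightarrow> ('h \<Rightarrow> 'h) \<Rightarrow> bool" where
  "is_idempotent ip Q \<longleftrightarrow> adjointable ip Q \<and> Q \<circ> Q = Q"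

definition kern :: "('h \<Rightarrow> 'h::zero) \<Rightarrow> 'h set" where
  "kern T = {x. T x = 0}"

definition hclosure :: "('h::ab_group_add \<Rightarrow> 'h \<Rightarrow> 'a::real_normed_vector) \<Rightarrow> 'h set \<Rightarrow> 'h set" where
  "hclosure ip S = {x. \<exists>X. (\<forall>n. X n \<in> S) \<and> hconv ip X x}"

definition orth :: "('h \<Rightarrow> 'h \<Rightarrow> 'a::zero) \<Rightarrow> 'h set \<Rightarrow> 'h set" where
  "orth ip M = {y. \<forall>x\<in>M. ip x y = 0}"

definition orth_complemented :: "('h::ab_group_add \<Rightarrow> 'h \<Rightarrow> 'a::zero) \<Rightarrow> 'h set \<Rightarrow> bool" where
  "orth_complemented ip M \<longleftrightarrow> (\<forall>h. \<exists>m\<in>M. \<exists>k\<in>orth ip M. h = m + k)"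

definition quasi_projection_pair :: "('h::ab_group_add \<Rightarrow> 'h \<Rightarrow> 'a) \<Rightarrow> ('h \<Rightarrow> 'h) \<Rightarrow> ('h \<Rightarrow> 'h) \<Rightarrow> bool" where
  "quasi_projection_pair ip P Q \<longleftrightarrow>
     is_projection ip P \<and> is_idempotent ip Q \<and>
     adj ip Q = (\<lambda>x. P x + P x - x) \<circ> Q \<circ> (\<lambda>x. P x + P x - x)"

definition harmonious :: "('h::ab_group_add \<Rightarrow> 'h \<Rightarrow> 'a::real_normed_vector) \<Rightarrow> ('h \<Rightarrow> 'h) \<Rightarrow> ('h \<Rightarrow> 'h) \<Rightarrow> bool" where
  "harmonious ip P Q \<longleftrightarrow> quasi_projection_pair ip P Q \<and>
     orth_complemented ip (hclosure ip (range (\<lambda>x. P (Q (x - P x))))) \<and>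
     orth_complemented ip (hclosure ip (range (\<lambda>x. Q (P x) - P (Q (P x)))))"

text \<open>An operator in L(M,N) is represented by a function on H; only its values on M matter.\<close>
definition adj_between :: "('h \<Rightarrow> 'h \<Rightarrow> 'a) \<Rightarrow> 'h set \<Rightarrow> 'h set \<Rightarrow> ('h \<Rightarrow> 'h) \<Rightarrow> bool" where
  "adj_between ip M N T \<longleftrightarrow> (\<forall>x\<in>M. T x \<in> N) \<and>
     (\<exists>S. (\<forall>y\<in>N. S y \<in> M) \<and> (\<forall>x\<in>M. \<forall>y\<in>N. ip (T x) y = ip x (S y)))"

definition adj_sub :: "('h \<Rightarrow> 'h \<Rightarrow> 'a) \<Rightarrow> 'h set \<Rightarrow> 'h set \<Rightarrow> ('h \<Rightarrow> 'h::zero) \<Rightarrow> ('h \<Rightarrow> 'h)" where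
  "adj_sub ip M N T = (THE S. (\<forall>y. y \<notin> N \<longrightarrow> S y = 0) \<and> (\<forall>y\<in>N. S y \<in> M) \<and>
                         (\<forall>x\<in>M. \<forall>y\<in>N. ip (T x) y = ip x (S y)))"

definition op_pos :: "('h \<Rightarrow> 'h \<Rightarrow> 'a) \<Rightarrow> 'h set \<Rightarrow> ('h \<Rightarrow> 'h::zero) \<Rightarrow> bool" where
  "op_pos ip M T \<longleftrightarrow> (\<exists>B. adj_between ip M M B \<and> (\<forall>x\<in>M. T x = adj_sub ip M M B (B x)))"

definition op_sqrt :: "('h \<Rightarrow> 'h \<Rightarrow> 'a) \<Rightarrow> 'h set \<Rightarrow> ('h \<Rightarrow> 'h::zero) \<Rightarrow> ('h \<Rightarrow> 'h)" where
  "op_sqrt ip M T = (THE L. (\<forall>x. x \<notin> M \<longrightarrow> L x = 0) \<and> adj_between ip M M L \<and> op_pos ip M L \<and>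
                        (\<forall>x\<in>M. L (L x) = T x))"

definition ell :: "('h \<Rightarrow> 'h \<Rightarrow> 'a) \<Rightarrow> 'h set \<Rightarrow> ('h \<Rightarrow> 'h::ab_group_add) \<Rightarrow> ('h \<Rightarrow> 'h)" where
  "ell ip M A = op_sqrt ip M (\<lambda>x. A (A x) - A x)"

definition sub_kern :: "'h set \<Rightarrow> ('h \<Rightarrow> 'h::zero) \<Rightarrow> 'h set" where
  "sub_kern M T = {x\<in>M. T x = 0}"

end

theory Submission
  imports Defs
begin

text \<open>
  Put \<open>T = A\<^sup>2 - A\<close>. It is self-adjoint and \<open>U\<^sup>*\<close> maps onto the closure of its range, so \<open>T\<close> and \<open>U\<close>
  have the same kernel; a partial isometry is unitary iff it and its adjoint are injective. The rest is
  algebra with \<open>T = A (A - 1)\<close>, \<open>U\<^sup>* Q\<^sub>0 = 0\<close> and the formula for \<open>Q\<^sub>2\<^sub>2\<close>.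

  The analytic content is that orthogonality passes to closures, which is the Cauchy-Schwarz inequality
  for the \<open>C\<^sup>*\<close>-valued inner product. It follows from \<open>norm (d\<^sup>* d) \<le> norm (c\<^sup>* c + d\<^sup>* d)\<close>,
  that is, from Kaplansky's theorem that every \<open>c\<^sup>* c\<close> is positive. No spectral theory is used: the
  algebra acts on itself by left multiplication, which supplies a unit, positivity of a self-adjoint \<open>a\<close>
  means \<open>norm (t - a) \<le> t\<close> for some \<open>t\<close>, and square roots come from the binomial series, which
  converges absolutely on the closed unit ball.
\<close>

section \<open>Square roots and positivity in unital normed algebras\<close>

definition sqrt_coeff :: "nat \<Rightarrow> real" where
  "sqrt_coeff n = (1/2 gchoose n) * (- 1) ^ n"

lemma sqrt_coeff_0: "sqrt_coeff 0 = 1"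
  by (simp add: sqrt_coeff_def)

lemma sqrt_coeff_Suc_nonpos: "sqrt_coeff (Suc n) \<le> 0"
proof -
  have "sqrt_coeff (Suc n) = - (pochhammer (1/2) n / (2 * fact (Suc n)))"
    by (simp add: sqrt_coeff_def gbinomial_pochhammer pochhammer_rec power_mult_distrib[symmetric])
  then show ?thesis using pochhammer_nonneg[of "1/2 :: real" n] by simp
qed

lemma sum_sqrt_coeff_nonneg: "0 \<le> (\<Sum>k\<le>n. sqrt_coeff k)"
proof -
  have "(\<Sum>k\<le>n. sqrt_coeff k) = pochhammer (1/2) n / fact n"
    unfolding sqrt_coeff_def gbinomial_sum_lower_neg
    by (simp add: gbinomial_pochhammer power_mult_distrib[symmetric])
  then show ?thesis using pochhammer_nonneg[of "1/2 :: real" n] by simp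
qed

lemma sum_abs_sqrt_coeff_Suc_le: "(\<Sum>k<n. \<bar>sqrt_coeff (Suc k)\<bar>) \<le> 1"
proof -
  have "(\<Sum>k\<le>n. sqrt_coeff k) = 1 - (\<Sum>k<n. \<bar>sqrt_coeff (Suc k)\<bar>)"
    by (simp add: sum.atMost_shift sqrt_coeff_0 abs_of_nonpos sqrt_coeff_Suc_nonpos sum_negf)
  then show ?thesis using sum_sqrt_coeff_nonneg[of n] by simp
qed

lemma summable_abs_sqrt_coeff_Suc: "summable (\<lambda>n. \<bar>sqrt_coeff (Suc n)\<bar>)"
  by (rule summableI_nonneg_bounded[OF _ sum_abs_sqrt_coeff_Suc_le]) simp

lemma suminf_abs_sqrt_coeff_Suc_le: "(\<Sum>n. \<bar>sqrt_coeff (Suc n)\<bar>) \<le> 1"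
  by (rule suminf_le_const[OF summable_abs_sqrt_coeff_Suc sum_abs_sqrt_coeff_Suc_le])

lemma summable_abs_sqrt_coeff: "summable (\<lambda>n. \<bar>sqrt_coeff n\<bar>)"
  using summable_abs_sqrt_coeff_Suc by (subst (asm) summable_Suc_iff)

lemma sum_sqrt_coeff_convolution:
  "(\<Sum>i\<le>n. sqrt_coeff i * sqrt_coeff (n - i)) = (if n = 0 then 1 else if n = 1 then - 1 else 0)"
proof -
  have "(\<Sum>i\<le>n. sqrt_coeff i * sqrt_coeff (n - i))
      = (\<Sum>i=0..n. (1/2 gchoose i) * (1/2 gchoose (n - i))) * (- 1) ^ n"
    unfolding sum_distrib_right atLeast0AtMost
    by (rule sum.cong) (simp_all add: sqrt_coeff_def flip: power_add)
  also have "\<dots> = of_nat (1 choose n) * (- 1) ^ n"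
    unfolding gbinomial_Vandermonde by (simp add: binomial_gbinomial)
  also have "\<dots> = (if n = 0 then 1 else if n = 1 then - 1 else 0)"
    by (cases "n \<le> 1") (auto simp: le_Suc_eq)
  finally show ?thesis .
qed

text \<open>\<open>adjr a a'\<close> says that \<open>a'\<close> is an adjoint of \<open>a\<close>, and \<open>J\<close> is multiplication by the imaginary unit.
  Adjoints form a relation because not every bounded operator has one.\<close>

locale star_algebra =
  fixes adjr :: "'b::{real_normed_algebra,monoid_mult,banach} \<Rightarrow> 'b \<Rightarrow> bool" and J :: 'b
  assumes norm_one_le: "norm (1::'b) \<le> 1"
    and adj_one: "adjr 1 1"
    and adj_add: "adjr a a' \<Longrightarrow> adjr b b' \<Longrightarrow> adjr (a + b) (a' + b')"
    and adj_scaleR: "adjr a a' \<Longrightarrow> adjr (r *\<^sub>R a) (r *\<^sub>R a')"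
    and adj_mult: "adjr a a' \<Longrightarrow> adjr b b' \<Longrightarrow> adjr (a * b) (b' * a')"
    and adj_sym: "adjr a a' \<Longrightarrow> adjr a' a"
    and adj_LIMSEQ: "(\<And>n. adjr (f n) (g n)) \<Longrightarrow> f \<longlonglongrightarrow> a \<Longrightarrow> g \<longlonglongrightarrow> a' \<Longrightarrow> adjr a a'"
    and norm_sq_le: "adjr a a' \<Longrightarrow> (norm a)\<^sup>2 \<le> norm (a' * a)"
    and J_square: "J * J = - 1"
    and J_adj: "adjr J (- J)"
    and J_central: "adjr a a' \<Longrightarrow> J * a = a * J"
begin

abbreviation sa :: "'b \<Rightarrow> bool" where "sa a \<equiv> adjr a a"

lemma adj_diff: "adjr a a' \<Longrightarrow> adjr b b' \<Longrightarrow> adjr (a - b) (a' - b')"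
  using adj_add[OF _ adj_scaleR[of b b' "- 1"]] by fastforce

lemma adj_zero: "sa 0"
  using adj_scaleR[OF adj_one, of 0] by simp

lemma sa_scaleR_one: "sa (r *\<^sub>R 1)"
  by (intro adj_scaleR adj_one)

lemma sa_mult: "sa a \<Longrightarrow> sa b \<Longrightarrow> a * b = b * a \<Longrightarrow> sa (a * b)"
  using adj_mult by metis

lemma sa_adj_mult: "adjr a a' \<Longrightarrow> sa (a' * a)"
  using adj_mult[OF adj_sym] by blast

lemma sa_power: "sa a \<Longrightarrow> sa (a ^ n)"
  by (induction n) (auto simp: adj_one power_commutes intro: sa_mult)

lemma sa_sum: "(\<And>i. i \<in> I \<Longrightarrow> sa (f i)) \<Longrightarrow> sa (sum f I)"
  by (induction I rule: infinite_finite_induct) (auto simp: adj_zero intro: adj_add)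

lemma sa_suminf:
  assumes "summable f" "\<And>n. sa (f n)"
  shows "sa (suminf f)"
  using adj_LIMSEQ[OF _ summable_LIMSEQ[OF assms(1)] summable_LIMSEQ[OF assms(1)]]
  by (simp add: sa_sum assms(2))

lemma norm_scaleR_one: "norm (r *\<^sub>R (1::'b)) \<le> \<bar>r\<bar>"
  using mult_left_mono[OF norm_one_le, of "\<bar>r\<bar>"] by simp

lemma norm_power_le_one: "norm (a::'b) \<le> 1 \<Longrightarrow> norm (a ^ n) \<le> 1"
proof (induction n)
  case (Suc n)
  then show ?case
    using norm_mult_ineq[of a "a ^ n"] mult_le_one[of "norm a" "norm (a ^ n)"] by simp
qed (simp add: norm_one_le)

lemma sa_norm_square: "sa a \<Longrightarrow> norm (a * a) = (norm a)\<^sup>2"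
  using norm_sq_le[of a a] norm_mult_ineq[of a a] by (simp add: power2_eq_square)

lemma sa_square_eq_zero: "sa a \<Longrightarrow> a * a = 0 \<Longrightarrow> a = 0"
  using sa_norm_square[of a] by simp

text \<open>\<open>m\<close> is half the sum of \<open>m + i k\<close> and its adjoint, whose product in either order is \<open>m\<^sup>2 + k\<^sup>2\<close>.\<close>

lemma norm_square_le_norm_sum_squares:
  assumes "sa m" "sa k" "m * k = k * m"
  shows "norm (m * m) \<le> norm (m * m + k * k)"
proof -
  have Jk: "J * k = k * J" by (rule J_central[OF assms(2)])
  have "adjr (J * k) (- (J * k))"
    using adj_mult[OF J_adj assms(2)] Jk by simp
  then have adj: "adjr (m + J * k) (m - J * k)"
    using adj_add[OF assms(1)] by fastforce
  have commute: "m * (J * k) = J * k * m"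
    using J_central[OF assms(1)] assms(3) by (metis mult.assoc)
  have "(J * k) * (J * k) = (J * J) * (k * k)"
    using Jk by (metis mult.assoc)
  then have "(J * k) * (J * k) = - (k * k)" by (simp add: J_square)
  then have "(m - J * k) * (m + J * k) = m * m + k * k" "(m + J * k) * (m - J * k) = m * m + k * k"
    by (simp_all add: commute distrib_left distrib_right left_diff_distrib right_diff_distrib)
  then have "(norm (m + J * k))\<^sup>2 \<le> norm (m * m + k * k)"
      "(norm (m - J * k))\<^sup>2 \<le> norm (m * m + k * k)"
    using norm_sq_le[OF adj] norm_sq_le[OF adj_sym[OF adj]] by simp_all
  then have "norm (m + J * k) \<le> sqrt (norm (m * m + k * k))"
      "norm (m - J * k) \<le> sqrt (norm (m * m + k * k))"
    by (simp_all only: real_le_rsqrt)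
  moreover have "norm (2 *\<^sub>R m) \<le> norm (m + J * k) + norm (m - J * k)"
    using norm_triangle_ineq[of "m + J * k" "m - J * k"] by (simp add: scaleR_2)
  ultimately have "norm m \<le> sqrt (norm (m * m + k * k))" by simp
  then show ?thesis
    using power_mono[of "norm m" "sqrt (norm (m * m + k * k))" 2]
    by (simp add: sa_norm_square[OF assms(1)])
qed

definition sqrt_one_minus :: "'b \<Rightarrow> 'b" where
  "sqrt_one_minus y = (\<Sum>n. sqrt_coeff n *\<^sub>R y ^ n)"

lemma norm_sqrt_series_le: "norm (y::'b) \<le> 1 \<Longrightarrow> norm (sqrt_coeff n *\<^sub>R y ^ n) \<le> \<bar>sqrt_coeff n\<bar>"
  using mult_left_mono[OF norm_power_le_one] by fastforce

lemma summable_norm_sqrt_series: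
  "norm (y::'b) \<le> 1 \<Longrightarrow> summable (\<lambda>n. norm (sqrt_coeff n *\<^sub>R y ^ n))"
  by (rule summable_norm_comparison_test[OF _ summable_abs_sqrt_coeff])
    (simp only: norm_sqrt_series_le, simp)

lemma summable_sqrt_series: "norm (y::'b) \<le> 1 \<Longrightarrow> summable (\<lambda>n. sqrt_coeff n *\<^sub>R y ^ n)"
  by (rule summable_norm_cancel[OF summable_norm_sqrt_series])

lemma sqrt_one_minus_square:
  assumes "norm y \<le> 1"
  shows "sqrt_one_minus y * sqrt_one_minus y = 1 - y"
proof -
  have "(\<Sum>i\<le>n. (sqrt_coeff i *\<^sub>R y ^ i) * (sqrt_coeff (n - i) *\<^sub>R y ^ (n - i)))
      = (if n = 0 then 1 else if n = 1 then - y else 0)" for n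
  proof -
    have "(\<Sum>i\<le>n. (sqrt_coeff i *\<^sub>R y ^ i) * (sqrt_coeff (n - i) *\<^sub>R y ^ (n - i)))
        = (\<Sum>i\<le>n. sqrt_coeff i * sqrt_coeff (n - i)) *\<^sub>R y ^ n"
      unfolding scaleR_sum_left by (rule sum.cong) (simp_all flip: power_add)
    then show ?thesis by (simp add: sum_sqrt_coeff_convolution)
  qed
  then have "(\<lambda>n. if n = 0 then 1 else if n = 1 then - y else 0)
      sums (sqrt_one_minus y * sqrt_one_minus y)"
    using Cauchy_product_sums[OF summable_norm_sqrt_series summable_norm_sqrt_series, OF assms assms]
    by (simp only: sqrt_one_minus_def)
  moreover have "(\<lambda>n::nat. if n = 0 then 1 else if n = 1 then - y else 0) sums
      (\<Sum>n\<in>{0, 1::nat}. if n = 0 then 1 else if n = 1 then - y else 0)"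
    by (rule sums_finite) auto
  ultimately show ?thesis
    by (auto dest: sums_unique2)
qed

lemma norm_one_minus_sqrt_le:
  assumes "norm y \<le> 1"
  shows "norm (1 - sqrt_one_minus y) \<le> 1"
proof -
  have "sqrt_one_minus y - 1 = (\<Sum>n. sqrt_coeff (Suc n) *\<^sub>R y ^ Suc n)"
    using suminf_split_head[OF summable_sqrt_series[OF assms]]
    by (simp add: sqrt_one_minus_def sqrt_coeff_0)
  moreover have "norm (\<Sum>n. sqrt_coeff (Suc n) *\<^sub>R y ^ Suc n) \<le> (\<Sum>n. \<bar>sqrt_coeff (Suc n)\<bar>)"
    using norm_sqrt_series_le[OF assms] summable_abs_sqrt_coeff_Suc by (rule norm_suminf_le)
  ultimately have "norm (sqrt_one_minus y - 1) \<le> 1"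
    using suminf_abs_sqrt_coeff_Suc_le by (simp only:)
  then show ?thesis by (simp add: norm_minus_commute)
qed

lemma sa_sqrt_one_minus: "sa y \<Longrightarrow> norm y \<le> 1 \<Longrightarrow> sa (sqrt_one_minus y)"
  unfolding sqrt_one_minus_def by (intro sa_suminf summable_sqrt_series adj_scaleR sa_power)

lemma sqrt_one_minus_commute:
  assumes "norm y \<le> 1" "b * y = y * b"
  shows "b * sqrt_one_minus y = sqrt_one_minus y * b"
  unfolding sqrt_one_minus_def
    suminf_mult[OF summable_sqrt_series[OF assms(1)], symmetric]
    suminf_mult2[OF summable_sqrt_series[OF assms(1)]]
  by (simp add: power_commuting_commutes[OF assms(2)[symmetric]])

text \<open>Equivalent to nonnegativity of the spectrum, but visibly a convex cone.\<close>

definition nneg :: "'b \<Rightarrow> bool" where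
  "nneg a \<longleftrightarrow> sa a \<and> (\<exists>t. norm (t *\<^sub>R 1 - a) \<le> t)"

lemma sa_if_nneg: "nneg a \<Longrightarrow> sa a"
  by (simp add: nneg_def)

lemma nneg_add:
  assumes "nneg a" "nneg b"
  shows "nneg (a + b)"
proof -
  obtain s t where "norm (s *\<^sub>R 1 - a) \<le> s" "norm (t *\<^sub>R 1 - b) \<le> t"
    using assms by (auto simp: nneg_def)
  moreover have "(s + t) *\<^sub>R 1 - (a + b) = (s *\<^sub>R 1 - a) + (t *\<^sub>R 1 - b)"
    by (simp add: scaleR_add_left)
  ultimately have "norm ((s + t) *\<^sub>R 1 - (a + b)) \<le> s + t"
    using norm_triangle_ineq[of "s *\<^sub>R 1 - a" "t *\<^sub>R 1 - b"] by (simp only:)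
  then show ?thesis
    using assms unfolding nneg_def by (auto intro: adj_add)
qed

lemma nneg_scaleR:
  assumes "nneg a" "0 \<le> r"
  shows "nneg (r *\<^sub>R a)"
proof -
  obtain t where "norm (t *\<^sub>R 1 - a) \<le> t"
    using assms by (auto simp: nneg_def)
  then have "norm (r *\<^sub>R (t *\<^sub>R 1 - a)) \<le> r * t"
    using assms(2) by (simp add: mult_left_mono)
  then have "norm ((r * t) *\<^sub>R 1 - r *\<^sub>R a) \<le> r * t"
    by (simp add: scaleR_diff_right)
  then show ?thesis
    using assms(1) unfolding nneg_def by (auto intro: adj_scaleR)
qed

lemma nneg_scaleR_one_diff: "sa a \<Longrightarrow> norm a \<le> r \<Longrightarrow> nneg (r *\<^sub>R 1 - a)"
  unfolding nneg_def by (intro conjI adj_diff sa_scaleR_one exI[of _ r]) simp_all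

lemma nneg_rescale:
  assumes "nneg a"
  obtains t where "t > 0" "norm (1 - (1 / t) *\<^sub>R a) \<le> 1"
proof -
  obtain s where norm_s: "norm (s *\<^sub>R 1 - a) \<le> s"
    using assms by (auto simp: nneg_def)
  define t where "t = s + 1"
  have t_pos: "t > 0" using norm_s norm_ge_zero[of "s *\<^sub>R 1 - a"] unfolding t_def by linarith
  have "norm (s *\<^sub>R 1 - a + 1) \<le> s + 1"
    using norm_s norm_triangle_ineq[of "s *\<^sub>R 1 - a" 1] norm_one_le by linarith
  then have "norm (t *\<^sub>R 1 - a) \<le> t"
    by (simp add: t_def scaleR_add_left diff_add_eq)
  moreover have "1 - (1 / t) *\<^sub>R a = (1 / t) *\<^sub>R (t *\<^sub>R 1 - a)"
    using t_pos by (simp add: scaleR_diff_right)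
  ultimately show ?thesis using t_pos that by simp
qed

lemma nneg_sqrt:
  assumes "nneg a"
  obtains s where "nneg s" "s * s = a" "\<And>b. b * a = a * b \<Longrightarrow> b * s = s * b"
proof -
  obtain t where t_pos: "t > 0" and norm_t: "norm (1 - (1 / t) *\<^sub>R a) \<le> 1"
    using assms by (rule nneg_rescale)
  define y where "y = 1 - (1 / t) *\<^sub>R a"
  have norm_y: "norm y \<le> 1" using norm_t by (simp add: y_def)
  have "sa y" unfolding y_def using assms by (intro adj_diff adj_one adj_scaleR sa_if_nneg)
  show ?thesis
  proof
    have "norm (1 *\<^sub>R 1 - sqrt_one_minus y) \<le> 1" using norm_one_minus_sqrt_le[OF norm_y] by simp
    then have "nneg (sqrt_one_minus y)"
      using sa_sqrt_one_minus[OF \<open>sa y\<close> norm_y] unfolding nneg_def by blast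
    then show "nneg (sqrt t *\<^sub>R sqrt_one_minus y)" using t_pos by (simp add: nneg_scaleR)
    show "(sqrt t *\<^sub>R sqrt_one_minus y) * (sqrt t *\<^sub>R sqrt_one_minus y) = a"
      using t_pos by (simp add: sqrt_one_minus_square[OF norm_y]) (simp add: y_def)
    fix b assume "b * a = a * b"
    then have "b * y = y * b" by (simp add: y_def left_diff_distrib right_diff_distrib)
    then show "b * (sqrt t *\<^sub>R sqrt_one_minus y) = (sqrt t *\<^sub>R sqrt_one_minus y) * b"
      by (simp add: sqrt_one_minus_commute[OF norm_y])
  qed
qed

lemma nneg_square:
  assumes "sa h"
  shows "nneg (h * h)"
proof -
  define r where "r = norm (h * h)"
  have "nneg (r *\<^sub>R 1 - h * h)"
    using assms by (intro nneg_scaleR_one_diff sa_adj_mult) (simp_all add: r_def)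
  then obtain s where s: "nneg s" "s * s = r *\<^sub>R 1 - h * h" "h * s = s * h"
    by (rule nneg_sqrt) (simp add: left_diff_distrib right_diff_distrib mult.assoc)
  have "norm (s * s) \<le> norm (s * s + h * h)"
    using assms s(3) by (intro norm_square_le_norm_sum_squares sa_if_nneg[OF s(1)]) simp_all
  also have "\<dots> \<le> r" using norm_scaleR_one[of r] by (simp add: s(2) r_def)
  finally have "norm (r *\<^sub>R 1 - h * h) \<le> r" by (simp only: s(2))
  then show ?thesis
    using sa_adj_mult[OF assms] by (auto simp: nneg_def)
qed

lemma norm_le_norm_add_commuting:
  assumes "nneg a" "nneg b" "a * b = b * a"
  shows "norm a \<le> norm (a + b)"
proof -
  obtain k where k: "nneg k" "k * k = a" "\<And>x. x * a = a * x \<Longrightarrow> x * k = k * x"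
    using nneg_sqrt[OF assms(1)] by blast
  obtain l where l: "nneg l" "l * l = b" "\<And>x. x * b = b * x \<Longrightarrow> x * l = l * x"
    using nneg_sqrt[OF assms(2)] by blast
  have "k * l = l * k" using k(3) l(3) assms(3) by metis
  then show ?thesis
    using norm_square_le_norm_sum_squares[of k l] k l sa_if_nneg by metis
qed

lemma norm_le_norm_add:
  assumes "nneg a" "nneg b"
  shows "norm a \<le> norm (a + b)"
proof -
  define r where "r = norm (a + b)"
  have "nneg ((r *\<^sub>R 1 - (a + b)) + b)"
    using assms by (intro nneg_add nneg_scaleR_one_diff adj_add sa_if_nneg) (simp_all add: r_def)
  then have "nneg (r *\<^sub>R 1 - a)" by simp
  from norm_le_norm_add_commuting[OF assms(1) this] have "norm a \<le> norm (r *\<^sub>R (1::'b))"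
    by (simp add: left_diff_distrib right_diff_distrib)
  then show ?thesis using norm_scaleR_one[of r] by (simp add: r_def)
qed

text \<open>With \<open>w = x + i y\<close>, this is \<open>2 (x\<^sup>2 + y\<^sup>2)\<close>.\<close>

lemma nneg_adj_anticommutator:
  assumes adj: "adjr w w'"
  shows "nneg (w * w' + w' * w)"
proof -
  define x where "x = w + w'"
  define y where "y = J * (w - w')"
  note adj' = adj_sym[OF adj]
  have "sa x" using adj_add[OF adj adj'] by (simp add: x_def add.commute)
  have diff: "adjr (w - w') (w' - w)" by (intro adj_diff adj adj')
  have J_diff: "J * (w - w') = (w - w') * J" by (rule J_central[OF diff])
  have "adjr y ((w' - w) * - J)" unfolding y_def by (intro adj_mult J_adj diff)
  also have "(w' - w) * - J = y"
    using J_diff by (simp add: y_def left_diff_distrib)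
  finally have "sa y" .
  have "y * y = (J * J) * ((w - w') * (w - w'))"
    unfolding y_def using J_diff by (metis mult.assoc)
  then have "y * y = - ((w - w') * (w - w'))" by (simp add: J_square)
  then have "x * x + y * y = 2 *\<^sub>R (w * w' + w' * w)"
    by (simp add: x_def scaleR_2 distrib_left distrib_right left_diff_distrib right_diff_distrib)
  moreover have "nneg ((1/2) *\<^sub>R (x * x + y * y))"
    using \<open>sa x\<close> \<open>sa y\<close> by (intro nneg_scaleR nneg_add nneg_square) auto
  ultimately show ?thesis by simp
qed

text \<open>For \<open>v = w m\<close>, both \<open>v' v = - m\<^sup>4\<close> and \<open>v v' = - (w w')\<^sup>2\<close> are nonpositive, while their sum is
  nonnegative. This replaces the comparison of the spectra of \<open>w' w\<close> and \<open>w w'\<close>.\<close>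

lemma eq_zero_if_adj_mult_eq_neg_square:
  assumes adj: "adjr w w'" and "sa m" and eq: "w' * w = - (m * m)"
  shows "m = 0"
proof -
  let ?u = "w * w'"
  have sa: "sa (m * m)" "sa ?u"
    using assms by (auto intro: sa_adj_mult adj_sym)
  have "(m * w') * (w * m) = m * (w' * w) * m" by (simp only: mult.assoc)
  also have "\<dots> = - ((m * m) * (m * m))" by (simp add: eq mult.assoc)
  finally have left: "(m * w') * (w * m) = - ((m * m) * (m * m))" .
  have "(w * m) * (m * w') = w * (m * m) * w'" by (simp only: mult.assoc)
  also have "m * m = - (w' * w)" by (simp add: eq)
  finally have right: "(w * m) * (m * w') = - (?u * ?u)" by (simp add: mult.assoc)
  let ?s = "(m * m) * (m * m) + ?u * ?u"
  have "adjr (w * m) (m * w')" by (intro adj_mult adj \<open>sa m\<close>)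
  from nneg_adj_anticommutator[OF this] have "nneg (- ?s)"
    by (simp add: left right add.commute)
  moreover have squares: "nneg ((m * m) * (m * m))" "nneg (?u * ?u)"
    using sa by (simp_all add: nneg_square)
  ultimately have "?s = 0"
    using norm_le_norm_add[of ?s "- ?s"] nneg_add by simp
  then have "(m * m) * (m * m) = 0"
    using norm_le_norm_add[OF squares] by simp
  then show ?thesis using sa(1) \<open>sa m\<close> sa_square_eq_zero by blast
qed

text \<open>Kaplansky's argument: with \<open>h = c' c\<close> and \<open>n = \<bar>h\<bar> - h\<close> (twice the negative part),
  \<open>(c n)' (c n) = n h n = - n \<bar>h\<bar> n\<close> is minus a square.\<close>

lemma nneg_adj_mult:
  assumes adj: "adjr c c'"
  shows "nneg (c' * c)"
proof -
  define h where "h = c' * c"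
  have "sa h" unfolding h_def by (rule sa_adj_mult[OF adj])
  obtain p where p: "nneg p" "p * p = h * h" and "h * p = p * h"
    using nneg_sqrt[OF nneg_square[OF \<open>sa h\<close>]] by (metis mult.assoc)
  define n where "n = p - h"
  have "sa n" unfolding n_def by (intro adj_diff sa_if_nneg p(1) \<open>sa h\<close>)
  have commute: "n * p = p * n" "n * h = h * n"
    using \<open>h * p = p * h\<close> by (simp_all add: n_def left_diff_distrib right_diff_distrib)
  have hn: "h * n = - (p * n)"
    using p(2) \<open>h * p = p * h\<close> by (simp add: n_def right_diff_distrib)
  obtain q where q: "nneg q" "q * q = p" and "n * q = q * n"
    using nneg_sqrt[OF p(1)] commute(1) by metis
  have sa_qn: "sa (q * n)"
    using \<open>n * q = q * n\<close> by (intro sa_mult sa_if_nneg q(1) \<open>sa n\<close>) simp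
  have qn_square: "(q * n) * (q * n) = p * n * n"
    using \<open>n * q = q * n\<close> q(2) by (metis mult.assoc)
  have "adjr (c * n) (n * c')" by (intro adj_mult adj \<open>sa n\<close>)
  moreover have "(n * c') * (c * n) = - ((q * n) * (q * n))"
  proof -
    have "(n * c') * (c * n) = n * h * n" by (simp only: h_def mult.assoc)
    then show ?thesis by (simp add: commute(2) hn qn_square)
  qed
  ultimately have "q * n = 0"
    using sa_qn eq_zero_if_adj_mult_eq_neg_square by blast
  then have "p * n * n = 0" using qn_square by simp
  moreover have "h * n * n = - (p * n * n)" by (simp add: hn)
  moreover have "n * n * n = p * n * n - h * n * n"
    by (subst (1) n_def) (simp add: left_diff_distrib)
  ultimately have "(n * n) * (n * n) = 0" by (simp flip: mult.assoc)
  then have "n = 0" using \<open>sa n\<close> sa_adj_mult sa_square_eq_zero by blast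
  then show ?thesis using p(1) by (simp add: n_def h_def)
qed

lemma norm_adj_mult_le_norm_add:
  "adjr c c' \<Longrightarrow> adjr d d' \<Longrightarrow> norm (d' * d) \<le> norm (c' * c + d' * d)"
  using norm_le_norm_add[of "d' * d" "c' * c"] by (simp add: nneg_adj_mult add.commute)

end

section \<open>Bounded operators on a \<open>C\<^sup>*\<close>-algebra\<close>

typedef (overloaded) 'a endo = "UNIV :: ('a::real_normed_vector \<Rightarrow>\<^sub>L 'a) set"
  morphisms blinfun_of_endo endo_of_blinfun ..

setup_lifting type_definition_endo

instantiation endo :: (real_normed_vector) real_normed_algebra
begin

lift_definition zero_endo :: "'a endo" is 0 .
lift_definition plus_endo :: "'a endo \<Rightarrow> 'a endo \<Rightarrow> 'a endo" is "(+)" .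
lift_definition minus_endo :: "'a endo \<Rightarrow> 'a endo \<Rightarrow> 'a endo" is "(-)" .
lift_definition uminus_endo :: "'a endo \<Rightarrow> 'a endo" is uminus .
lift_definition scaleR_endo :: "real \<Rightarrow> 'a endo \<Rightarrow> 'a endo" is scaleR .
lift_definition times_endo :: "'a endo \<Rightarrow> 'a endo \<Rightarrow> 'a endo" is "(o\<^sub>L)" .
lift_definition norm_endo :: "'a endo \<Rightarrow> real" is norm .

definition sgn_endo :: "'a endo \<Rightarrow> 'a endo" where
  "sgn_endo T = inverse (norm T) *\<^sub>R T"
definition dist_endo :: "'a endo \<Rightarrow> 'a endo \<Rightarrow> real" where
  "dist_endo S T = norm (S - T)"
definition uniformity_endo :: "('a endo \<times> 'a endo) filter" where
  "uniformity_endo = (INF e\<in>{0<..}. principal {(S, T). dist S T < e})"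
definition open_endo :: "'a endo set \<Rightarrow> bool" where
  "open_endo X \<longleftrightarrow> (\<forall>S\<in>X. \<forall>\<^sub>F (S', T) in uniformity. S' = S \<longrightarrow> T \<in> X)"

instance
proof
  fix S T R :: "'a endo" and r s :: real
  show "S * T * R = S * (T * R)" by transfer (auto intro!: blinfun_eqI)
  show "(S + T) * R = S * R + T * R" by transfer (auto intro!: blinfun_eqI simp: blinfun.bilinear_simps)
  show "S * (T + R) = S * T + S * R" by transfer (auto intro!: blinfun_eqI simp: blinfun.bilinear_simps)
  show "r *\<^sub>R S * T = r *\<^sub>R (S * T)" by transfer (auto intro!: blinfun_eqI simp: blinfun.bilinear_simps)
  show "S * r *\<^sub>R T = r *\<^sub>R (S * T)" by transfer (auto intro!: blinfun_eqI simp: blinfun.bilinear_simps)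
  show "norm (S * T) \<le> norm S * norm T" by transfer (rule norm_blinfun_compose)
  show "norm (S + T) \<le> norm S + norm T" by transfer (rule norm_triangle_ineq)
  show "norm S = 0 \<longleftrightarrow> S = 0" by transfer simp
  show "norm (r *\<^sub>R S) = \<bar>r\<bar> * norm S" by transfer simp
qed (rule sgn_endo_def dist_endo_def uniformity_endo_def open_endo_def |
    (transfer, simp add: algebra_simps))+

end

instantiation endo :: (real_normed_vector) monoid_mult
begin

lift_definition one_endo :: "'a endo" is id_blinfun .

instance
  by standard (transfer, auto intro!: blinfun_eqI)+

end

lemma dist_blinfun_of_endo: "dist (blinfun_of_endo S) (blinfun_of_endo T) = dist S T"
  unfolding dist_norm by transfer (rule refl)

instance endo :: (banach) banach
proof
  fix X :: "nat \<Rightarrow> 'a endo"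
  assume "Cauchy X"
  then have "Cauchy (\<lambda>n. blinfun_of_endo (X n))"
    by (simp add: Cauchy_def dist_blinfun_of_endo)
  then obtain L where "(\<lambda>n. blinfun_of_endo (X n)) \<longlonglongrightarrow> L"
    by (auto simp: Cauchy_convergent_iff convergent_def)
  then have "X \<longlonglongrightarrow> endo_of_blinfun L"
    by (simp add: lim_sequentially endo_of_blinfun_inverse flip: dist_blinfun_of_endo)
  then show "convergent X" by (rule convergentI)
qed

lift_definition endo_apply :: "'a::real_normed_vector endo \<Rightarrow> 'a \<Rightarrow> 'a" is blinfun_apply .

lemma endo_eqI: "(\<And>x. endo_apply S x = endo_apply T x) \<Longrightarrow> S = T"
  by transfer (rule blinfun_eqI)

lemma endo_apply_simps [simp]:
  "endo_apply 1 x = x"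
  "endo_apply (S * T) x = endo_apply S (endo_apply T x)"
  "endo_apply (S + T) x = endo_apply S x + endo_apply T x"
  "endo_apply (- S) x = - endo_apply S x"
  "endo_apply (r *\<^sub>R S) x = r *\<^sub>R endo_apply S x"
  by (transfer, simp add: blinfun.bilinear_simps)+

lemma norm_endo_apply: "norm (endo_apply T x) \<le> norm T * norm x"
  by transfer (rule norm_blinfun)

lemma norm_endo_bound:
  "0 \<le> b \<Longrightarrow> (\<And>x. norm (endo_apply T x) \<le> b * norm x) \<Longrightarrow> norm T \<le> b"
  by transfer (rule norm_blinfun_bound)

lemma bounded_linear_endo_apply_left: "bounded_linear (\<lambda>T. endo_apply T x)"
  by (rule bounded_linear_intro[where K = "norm x"]) (simp_all add: norm_endo_apply)

lift_definition endo_of :: "('a \<Rightarrow> 'a) \<Rightarrow> 'a::real_normed_vector endo" is Blinfun .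

lemma endo_apply_endo_of: "bounded_linear f \<Longrightarrow> endo_apply (endo_of f) = f"
  by transfer (rule bounded_linear_Blinfun_apply)

lift_definition left_mult :: "'a::real_normed_algebra \<Rightarrow> 'a endo" is blinfun_mult_right .

lemma endo_apply_left_mult [simp]: "endo_apply (left_mult a) x = a * x"
  by transfer simp

lemma left_mult_add: "left_mult (a + b) = left_mult a + left_mult b"
  by (rule endo_eqI) (simp add: distrib_right)

lemma left_mult_mult: "left_mult (a * b) = left_mult a * left_mult b"
  by (rule endo_eqI) (simp add: mult.assoc)

locale cstar =
  fixes scA :: "complex \<Rightarrow> 'a::{real_normed_algebra,banach} \<Rightarrow> 'a" and st :: "'a \<Rightarrow> 'a"
  assumes cstar_algebra: "cstar_algebra scA st"
begin

lemma scA_of_real: "scA (complex_of_real r) a = r *\<^sub>R a"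
  and scA_add: "scA c (a + b) = scA c a + scA c b"
  and scA_scA: "scA c (scA d a) = scA (c * d) a"
  and scA_mult: "scA c a * b = scA c (a * b)" "a * scA c b = scA c (a * b)"
  and norm_scA: "norm (scA c a) = cmod c * norm a"
  and st_add: "st (a + b) = st a + st b"
  and st_scA: "st (scA c a) = scA (cnj c) (st a)"
  and st_mult: "st (a * b) = st b * st a"
  and st_st: "st (st a) = a"
  and norm_st_mult: "norm (st a * a) = (norm a)\<^sup>2"
  using cstar_algebra unfolding cstar_algebra_def by metis+

lemma scA_minus_ii: "scA (- \<i>) a = - scA \<i> a"
  using scA_scA[of "of_real (- 1)" \<i> a] by (simp only: scA_of_real) simp

lemma norm_st: "norm (st a) = norm a"
proof -
  have norm_le: "norm b \<le> norm (st b)" for b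
  proof (cases "b = 0")
    case False
    have "norm b * norm b \<le> norm (st b) * norm b"
      using norm_st_mult[of b] norm_mult_ineq[of "st b" b] by (simp add: power2_eq_square)
    then show ?thesis using False by simp
  qed simp
  show ?thesis using norm_le[of a] norm_le[of "st a"] by (simp add: st_st)
qed

lemma bounded_linear_scA: "bounded_linear (scA c)"
proof (rule bounded_linear_intro)
  show "scA c (r *\<^sub>R a) = r *\<^sub>R scA c a" for r a
    by (simp only: scA_of_real[symmetric] scA_scA mult.commute)
  show "norm (scA c a) \<le> norm a * cmod c" for a
    by (simp add: norm_scA)
qed (rule scA_add)

lemma st_scaleR: "st (r *\<^sub>R a) = r *\<^sub>R st a"
  using st_scA[of "of_real r" a] by (simp only: scA_of_real complex_cnj_complex_of_real)

lemma bounded_linear_st: "bounded_linear st"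
  by (rule bounded_linear_intro[where K = 1]) (simp_all add: st_add st_scaleR norm_st)

lemma st_mult_cancel:
  assumes "\<And>y. st a * y = st b * y"
  shows "a = b"
proof -
  have "st (a - b) * (a - b) = 0"
    by (simp add: linear_diff[OF bounded_linear.linear[OF bounded_linear_st]] left_diff_distrib assms)
  then show ?thesis using norm_st_mult[of "a - b"] by simp
qed

definition endo_adj :: "'a endo \<Rightarrow> 'a endo \<Rightarrow> bool" where
  "endo_adj T S \<longleftrightarrow> (\<forall>x y. st (endo_apply T x) * y = st x * endo_apply S y)"

lemma endo_adj_sym:
  assumes "endo_adj T S"
  shows "endo_adj S T"
  unfolding endo_adj_def
proof (intro allI)
  fix x y
  have "st (st (endo_apply T y) * x) = st (st y * endo_apply S x)"
    using assms by (simp add: endo_adj_def)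
  then show "st (endo_apply S x) * y = st x * endo_apply T y" by (simp add: st_mult st_st)
qed

lemma endo_adj_LIMSEQ:
  assumes adj: "\<And>n. endo_adj (F n) (G n)" and lim: "F \<longlonglongrightarrow> T" "G \<longlonglongrightarrow> S"
  shows "endo_adj T S"
  unfolding endo_adj_def
proof (intro allI)
  fix x y
  note apply_tendsto = bounded_linear.tendsto[OF bounded_linear_endo_apply_left]
  have "(\<lambda>n. st (endo_apply (F n) x) * y) \<longlonglongrightarrow> st (endo_apply T x) * y"
    by (intro tendsto_mult_right bounded_linear.tendsto[OF bounded_linear_st] apply_tendsto lim)
  moreover have "(\<lambda>n. st (endo_apply (F n) x) * y) \<longlonglongrightarrow> st x * endo_apply S y"
    using adj unfolding endo_adj_def by (simp add: tendsto_mult_left apply_tendsto lim)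
  ultimately show "st (endo_apply T x) * y = st x * endo_apply S y"
    by (rule LIMSEQ_unique)
qed

lemma norm_square_le_endo_adj_mult:
  assumes "endo_adj T S"
  shows "(norm T)\<^sup>2 \<le> norm (S * T)"
proof -
  have "norm (endo_apply T x) \<le> sqrt (norm (S * T)) * norm x" for x
  proof (rule power2_le_imp_le)
    have "(norm (endo_apply T x))\<^sup>2 = norm (st x * endo_apply (S * T) x)"
      using assms by (simp add: norm_st_mult[symmetric] endo_adj_def)
    also have "\<dots> \<le> norm x * (norm (S * T) * norm x)"
      using norm_mult_ineq[of "st x" "endo_apply (S * T) x"]
        mult_left_mono[OF norm_endo_apply[of "S * T" x] norm_ge_zero[of x]]
      unfolding norm_st by linarith
    also have "\<dots> = (sqrt (norm (S * T)) * norm x)\<^sup>2"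
      by (simp add: power_mult_distrib power2_eq_square[of "norm x"])
    finally show "(norm (endo_apply T x))\<^sup>2 \<le> (sqrt (norm (S * T)) * norm x)\<^sup>2" .
  qed simp
  then have "norm T \<le> sqrt (norm (S * T))" by (intro norm_endo_bound) auto
  then show ?thesis using power_mono[of "norm T" "sqrt (norm (S * T))" 2] by simp
qed

lemma endo_adj_apply_scA:
  assumes "endo_adj T S"
  shows "endo_apply T (scA c x) = scA c (endo_apply T x)"
proof (rule st_mult_cancel)
  show "st (endo_apply T (scA c x)) * y = st (scA c (endo_apply T x)) * y" for y
    using assms by (simp add: endo_adj_def st_scA scA_mult)
qed

lemma star_algebra_endo: "star_algebra endo_adj (endo_of (scA \<i>))"
proof
  note apply_J = endo_apply_endo_of[OF bounded_linear_scA]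
  show "norm (1 :: 'a endo) \<le> 1" by (rule norm_endo_bound) auto
  show "endo_adj 1 1" by (simp add: endo_adj_def)
  show "endo_of (scA \<i>) * endo_of (scA \<i>) = - 1"
    using scA_of_real[of "-1"] by (intro endo_eqI) (simp add: apply_J scA_scA)
  show "endo_adj (endo_of (scA \<i>)) (- endo_of (scA \<i>))"
    by (simp add: endo_adj_def apply_J st_scA scA_mult scA_minus_ii)
  fix T S T' S' :: "'a endo" and r :: real
  assume adj: "endo_adj T S"
  show "endo_adj (r *\<^sub>R T) (r *\<^sub>R S)"
    using adj by (simp add: endo_adj_def st_scaleR)
  show "endo_of (scA \<i>) * T = T * endo_of (scA \<i>)"
    by (rule endo_eqI) (simp add: apply_J endo_adj_apply_scA[OF adj])
  assume adj': "endo_adj T' S'"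
  show "endo_adj (T + T') (S + S')"
    using adj adj' by (simp add: endo_adj_def st_add distrib_left distrib_right)
  show "endo_adj (T * T') (S' * S)"
    using adj adj' by (simp add: endo_adj_def)
qed (fact endo_adj_sym endo_adj_LIMSEQ norm_square_le_endo_adj_mult)+

lemma endo_adj_left_mult: "endo_adj (left_mult a) (left_mult (st a))"
  by (simp add: endo_adj_def st_mult mult.assoc)

lemma norm_left_mult: "norm (left_mult (a :: 'a)) = norm a"
proof (rule antisym)
  show "norm (left_mult a) \<le> norm a"
    by (rule norm_endo_bound) (simp_all add: norm_mult_ineq)
  show "norm a \<le> norm (left_mult a)"
  proof (cases "a = 0")
    case False
    have "norm a * norm a = norm (endo_apply (left_mult a) (st a))"
      using norm_st_mult[of "st a"] by (simp add: st_st norm_st power2_eq_square)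
    also have "\<dots> \<le> norm (left_mult a) * norm a"
      using norm_endo_apply[of "left_mult a" "st a"] by (simp add: norm_st)
    finally show ?thesis using False by simp
  qed simp
qed

lemma norm_st_mult_le_norm_add: "norm (st d * d) \<le> norm (st c * c + st d * d)"
  using star_algebra.norm_adj_mult_le_norm_add
      [OF star_algebra_endo endo_adj_left_mult[of c] endo_adj_left_mult[of d]]
  by (simp only: norm_left_mult flip: left_mult_add left_mult_mult)

end

section \<open>Hilbert modules\<close>

definition additive_subgroup :: "'h::ab_group_add set \<Rightarrow> bool" where
  "additive_subgroup M \<longleftrightarrow> 0 \<in> M \<and> (\<forall>x\<in>M. \<forall>y\<in>M. x - y \<in> M)"

lemma additive_subgroup_zero: "additive_subgroup M \<Longrightarrow> 0 \<in> M"
  and additive_subgroup_diff: "additive_subgroup M \<Longrightarrow> x \<in> M \<Longrightarrow> y \<in> M \<Longrightarrow> x - y \<in> M"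
  by (simp_all add: additive_subgroup_def)

lemma sub_kern_eq_zero_iff:
  "0 \<in> M \<Longrightarrow> T 0 = 0 \<Longrightarrow> sub_kern M T = {0} \<longleftrightarrow> (\<forall>x\<in>M. T x = 0 \<longrightarrow> x = 0)"
  by (auto simp: sub_kern_def)

lemma sub_kern_trivialD: "sub_kern M T = {0} \<Longrightarrow> x \<in> M \<Longrightarrow> T x = 0 \<Longrightarrow> x = 0"
  by (auto simp: sub_kern_def)

lemma sub_kern_comp_eq_zero_iff:
  assumes "0 \<in> M" "S 0 = 0" "T 0 = 0" "\<And>x. x \<in> M \<Longrightarrow> T x \<in> M"
    and commute: "\<And>x. x \<in> M \<Longrightarrow> S (T x) = T (S x)"
  shows "sub_kern M (\<lambda>x. S (T x)) = {0} \<longleftrightarrow> sub_kern M S = {0} \<and> sub_kern M T = {0}"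
proof -
  have "(\<forall>x\<in>M. S (T x) = 0 \<longrightarrow> x = 0)
      \<longleftrightarrow> (\<forall>x\<in>M. S x = 0 \<longrightarrow> x = 0) \<and> (\<forall>x\<in>M. T x = 0 \<longrightarrow> x = 0)"
    using assms by metis
  then show ?thesis using assms(1-3) by (simp add: sub_kern_eq_zero_iff)
qed

definition adjoint_on ::
  "('h \<Rightarrow> 'h \<Rightarrow> 'a) \<Rightarrow> 'h set \<Rightarrow> 'h set \<Rightarrow> ('h \<Rightarrow> 'h) \<Rightarrow> ('h \<Rightarrow> 'h) \<Rightarrow> bool" where
  "adjoint_on ip M N T S \<longleftrightarrow> (\<forall>x\<in>M. T x \<in> N) \<and> (\<forall>y\<in>N. S y \<in> M) \<and>
     (\<forall>x\<in>M. \<forall>y\<in>N. ip (T x) y = ip x (S y))"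

lemma adjoint_on_in: "adjoint_on ip M N T S \<Longrightarrow> x \<in> M \<Longrightarrow> T x \<in> N"
  and adjoint_on_adj_in: "adjoint_on ip M N T S \<Longrightarrow> y \<in> N \<Longrightarrow> S y \<in> M"
  and adjoint_on_ip: "adjoint_on ip M N T S \<Longrightarrow> x \<in> M \<Longrightarrow> y \<in> N \<Longrightarrow> ip (T x) y = ip x (S y)"
  by (simp_all add: adjoint_on_def)

lemma adj_between_iff_adjoint_on: "adj_between ip M N T \<longleftrightarrow> (\<exists>S. adjoint_on ip M N T S)"
  by (auto simp: adj_between_def adjoint_on_def)

lemma adjoint_on_comp:
  "adjoint_on ip M N T S \<Longrightarrow> adjoint_on ip N K T' S' \<Longrightarrow>
    adjoint_on ip M K (\<lambda>x. T' (T x)) (\<lambda>y. S (S' y))"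
  by (simp add: adjoint_on_def)

definition partial_isometry_on :: "'h set \<Rightarrow> ('h \<Rightarrow> 'h) \<Rightarrow> ('h \<Rightarrow> 'h) \<Rightarrow> bool" where
  "partial_isometry_on M V W \<longleftrightarrow> (\<forall>x\<in>M. V (W (V x)) = V x)"

definition unitary_on :: "'h set \<Rightarrow> 'h set \<Rightarrow> ('h \<Rightarrow> 'h) \<Rightarrow> ('h \<Rightarrow> 'h) \<Rightarrow> bool" where
  "unitary_on M N V W \<longleftrightarrow> (\<forall>x\<in>M. W (V x) = x) \<and> (\<forall>y\<in>N. V (W y) = y)"

locale hilbert_module = cstar scA st
  for scA :: "complex \<Rightarrow> 'a::{real_normed_algebra,banach} \<Rightarrow> 'a" and st :: "'a \<Rightarrow> 'a" +
  fixes scH :: "complex \<Rightarrow> 'h::ab_group_add \<Rightarrow> 'h"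
    and act :: "'h \<Rightarrow> 'a \<Rightarrow> 'h"
    and ip :: "'h \<Rightarrow> 'h \<Rightarrow> 'a"
  assumes hilbert_cstar_module: "hilbert_cstar_module scA st scH act ip"
begin

lemma ip_add_right: "ip x (y + z) = ip x y + ip x z"
  and ip_scH_right: "ip x (scH c y) = scA c (ip x y)"
  and ip_act_right: "ip x (act y a) = ip x y * a"
  and st_ip: "st (ip x y) = ip y x"
  and ip_self_pos: "cstar_pos st (ip x x)"
  and ip_self_eq_0: "ip x x = 0 \<Longrightarrow> x = 0"
  using hilbert_cstar_module unfolding hilbert_cstar_module_def by metis+

lemma ip_add_left: "ip (x + y) z = ip x z + ip y z"
  by (metis ip_add_right st_ip st_add)

lemma ip_diff_right: "ip x (y - z) = ip x y - ip x z"
  using ip_add_right[of x "y - z" z] by simp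

lemma ip_diff_left: "ip (x - y) z = ip x z - ip y z"
  using ip_add_left[of "x - y" y z] by simp

lemma ip_zero_right: "ip x 0 = 0"
  using ip_diff_right[of x 0 0] by simp

lemma ip_zero_left: "ip 0 x = 0"
  using ip_diff_left[of 0 0 x] by simp

lemma ip_act_left: "ip (act x a) y = st a * ip x y"
  by (metis ip_act_right st_ip st_mult)

lemma ip_scH_of_real_right: "ip x (scH (of_real r) y) = r *\<^sub>R ip x y"
  by (simp only: ip_scH_right scA_of_real)

lemma ip_scH_of_real_left: "ip (scH (of_real r) x) y = r *\<^sub>R ip x y"
  by (metis ip_scH_of_real_right st_ip st_scaleR)

lemma hnorm_nonneg: "0 \<le> hnorm ip x"
  by (simp add: hnorm_def)

text \<open>For \<open>a = \<langle>x, y\<rangle>\<close> and \<open>t = norm \<langle>x, x\<rangle>\<close>, the vector \<open>z = x a - t y\<close> satisfies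
  \<open>\<langle>z, z\<rangle> + 2 t a\<^sup>* a = a\<^sup>* \<langle>x, x\<rangle> a + t\<^sup>2 \<langle>y, y\<rangle>\<close>.\<close>

lemma norm_ip_square_le: "(norm (ip x y))\<^sup>2 \<le> norm (ip x x) * norm (ip y y)"
proof (cases "x = 0")
  case False
  define t where "t = norm (ip x x)"
  have t_pos: "t > 0" using False ip_self_eq_0 by (auto simp: t_def)
  define a where "a = ip x y"
  define z where "z = act x a - scH (of_real t) y"
  define d where "d = sqrt (2 * t) *\<^sub>R a"
  have st_d_d: "st d * d = (2 * t) *\<^sub>R (st a * a)"
    using t_pos by (simp add: d_def st_scaleR)
  have "ip z z = st a * ip x x * a - t *\<^sub>R (st a * a) - t *\<^sub>R (st a * a) + (t * t) *\<^sub>R ip y y"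
    by (simp add: z_def ip_diff_left ip_diff_right ip_act_left ip_act_right left_diff_distrib
        ip_scH_of_real_left ip_scH_of_real_right st_ip a_def mult.assoc scaleR_diff_right)
  then have ip_z_z: "ip z z + st d * d = st a * ip x x * a + (t * t) *\<^sub>R ip y y"
    using scaleR_add_left[of t t "st a * a"] by (simp add: st_d_d)
  obtain b where "ip z z = st b * b" using ip_self_pos by (auto simp: cstar_pos_def)
  then have "norm (st d * d) \<le> norm (st a * ip x x * a + (t * t) *\<^sub>R ip y y)"
    using norm_st_mult_le_norm_add[of d b] ip_z_z by simp
  also have "\<dots> \<le> norm (st a * ip x x * a) + t * t * norm (ip y y)"
    using norm_triangle_ineq[of "st a * ip x x * a" "(t * t) *\<^sub>R ip y y"] by simp
  also have "norm (st a * ip x x * a) \<le> norm (st a * ip x x) * norm a"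
    by (rule norm_mult_ineq)
  also have "\<dots> \<le> norm a * t * norm a"
    using norm_mult_ineq[of "st a" "ip x x"] by (intro mult_right_mono) (simp_all add: norm_st t_def)
  finally have "t * (norm a)\<^sup>2 \<le> t * (t * norm (ip y y))"
    using t_pos by (simp add: st_d_d norm_st_mult) (simp add: power2_eq_square algebra_simps)
  then show ?thesis using t_pos by (simp add: a_def t_def)
qed (simp add: ip_zero_left)

lemma norm_ip_le: "norm (ip x y) \<le> hnorm ip x * hnorm ip y"
  unfolding hnorm_def real_sqrt_mult[symmetric] by (rule real_le_rsqrt[OF norm_ip_square_le])

lemma subset_hclosure: "S \<subseteq> hclosure ip S"
proof
  fix x assume "x \<in> S"
  then show "x \<in> hclosure ip S"
    unfolding hclosure_def hconv_def
    by (intro CollectI exI[of _ "\<lambda>_. x"]) (simp add: hnorm_def ip_zero_left)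
qed

lemma hconv_ip_eq_0:
  assumes conv: "hconv ip X x" and orth: "\<And>n. ip (X n) y = 0"
  shows "ip x y = 0"
proof -
  have "norm (ip x y) \<le> 0 + e" if e: "e > 0" for e
  proof -
    have pos: "hnorm ip y + 1 > 0" using hnorm_nonneg[of y] by linarith
    then obtain n where close: "hnorm ip (X n - x) < e / (hnorm ip y + 1)"
      using conv e unfolding hconv_def by (meson divide_pos_pos order_refl)
    have "norm (ip x y) = norm (ip (X n - x) y)"
      by (simp add: orth ip_diff_left)
    also have "\<dots> \<le> hnorm ip (X n - x) * hnorm ip y"
      by (rule norm_ip_le)
    also have "\<dots> \<le> hnorm ip (X n - x) * (hnorm ip y + 1)"
      by (simp add: hnorm_nonneg mult_left_mono)
    also have "\<dots> \<le> 0 + e" using close pos by (simp add: field_simps)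
    finally show ?thesis .
  qed
  then have "norm (ip x y) \<le> 0" by (rule field_le_epsilon)
  then show ?thesis by simp
qed

lemma orth_hclosure: "orth ip (hclosure ip S) = orth ip S"
proof
  show "orth ip (hclosure ip S) \<subseteq> orth ip S"
    using subset_hclosure by (auto simp: orth_def)
  show "orth ip S \<subseteq> orth ip (hclosure ip S)"
    by (auto simp: orth_def hclosure_def intro: hconv_ip_eq_0)
qed

lemma eq_if_ip_eq:
  assumes "additive_subgroup M" "x \<in> M" "y \<in> M" "\<And>z. z \<in> M \<Longrightarrow> ip z x = ip z y"
  shows "x = y"
proof -
  have "ip (x - y) (x - y) = 0"
    using assms by (simp add: ip_diff_right[of "x - y"] additive_subgroup_diff)
  from ip_self_eq_0[OF this] show ?thesis by simp
qed

lemma adjoint_on_sym: "adjoint_on ip M N T S \<Longrightarrow> adjoint_on ip N M S T"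
  unfolding adjoint_on_def by (metis st_ip)

lemma adjoint_on_apply_diff:
  assumes "adjoint_on ip M N T S" "additive_subgroup M" "additive_subgroup N" "x \<in> M" "y \<in> M"
  shows "T (x - y) = T x - T y"
proof (rule eq_if_ip_eq[of N])
  note adj = adjoint_on_sym[OF assms(1)]
  have "x - y \<in> M" by (intro additive_subgroup_diff assms)
  then show "T (x - y) \<in> N" "T x - T y \<in> N"
    using assms by (auto intro: additive_subgroup_diff adjoint_on_in)
  show "ip z (T (x - y)) = ip z (T x - T y)" if "z \<in> N" for z
    using assms that \<open>x - y \<in> M\<close> by (simp add: ip_diff_right flip: adjoint_on_ip[OF adj])
qed (rule assms)

lemma adjoint_on_apply_zero:
  assumes "adjoint_on ip M N T S" "additive_subgroup M" "additive_subgroup N"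
  shows "T 0 = 0"
  using adjoint_on_apply_diff[OF assms, of 0 0] assms(2) by (simp add: additive_subgroup_zero)

lemma adjoint_on_diff:
  assumes "adjoint_on ip M N T S" "adjoint_on ip M N T' S'" "additive_subgroup M" "additive_subgroup N"
  shows "adjoint_on ip M N (\<lambda>x. T x - T' x) (\<lambda>y. S y - S' y)"
  using assms by (simp add: adjoint_on_def additive_subgroup_diff ip_diff_left ip_diff_right)

lemma sub_kern_eq_orth_range_adjoint:
  assumes "adjoint_on ip M N T S" "additive_subgroup M" "additive_subgroup N"
  shows "sub_kern M T = M \<inter> orth ip (S ` N)"
proof -
  have "T x = 0 \<longleftrightarrow> (\<forall>y\<in>N. ip (S y) x = 0)" if x: "x \<in> M" for x
  proof -
    have "T x = 0 \<longleftrightarrow> (\<forall>y\<in>N. ip y (T x) = 0)"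
      using eq_if_ip_eq[OF assms(3), of "T x" 0] adjoint_on_in[OF assms(1) x]
        additive_subgroup_zero[OF assms(3)] by (auto simp: ip_zero_right)
    then show ?thesis using x by (simp add: adjoint_on_ip[OF adjoint_on_sym[OF assms(1)]])
  qed
  then show ?thesis by (auto simp: sub_kern_def orth_def)
qed

lemma adjoint_on_adj_sub:
  assumes T: "adj_between ip M N T" and M: "additive_subgroup M"
  shows "adjoint_on ip M N T (adj_sub ip M N T)"
proof -
  obtain S where S: "adjoint_on ip M N T S"
    using T by (auto simp: adj_between_iff_adjoint_on)
  let ?P = "\<lambda>S. (\<forall>y. y \<notin> N \<longrightarrow> S y = 0) \<and> (\<forall>y\<in>N. S y \<in> M) \<and> (\<forall>x\<in>M. \<forall>y\<in>N. ip (T x) y = ip x (S y))"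
  have "\<exists>!S. ?P S"
  proof (rule ex1I)
    show "?P (\<lambda>y. if y \<in> N then S y else 0)" using S by (simp add: adjoint_on_def)
    fix R assume R: "?P R"
    have "R y = S y" if "y \<in> N" for y
      using that R S by (intro eq_if_ip_eq[OF M]) (auto simp: adjoint_on_def)
    then show "R = (\<lambda>y. if y \<in> N then S y else 0)" using R by auto
  qed
  then have "?P (adj_sub ip M N T)" unfolding adj_sub_def by (rule theI')
  then show ?thesis using T by (simp add: adj_between_def adjoint_on_def)
qed

lemma adjoint_on_projection:
  assumes "is_projection ip P"
  shows "adjoint_on ip UNIV UNIV P P"
proof -
  have "adj_between ip UNIV UNIV P" and "adj_sub ip UNIV UNIV P = P"
    using assms by (simp_all add: is_projection_def adjointable_def adj_between_def adj_def adj_sub_def)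
  then show ?thesis
    using adjoint_on_adj_sub[of UNIV UNIV P] by (simp add: additive_subgroup_def)
qed

lemma additive_subgroup_projection:
  assumes "is_projection ip P"
  shows "additive_subgroup (range P)" "additive_subgroup (kern P)"
proof -
  have subgroup_UNIV: "additive_subgroup (UNIV :: 'h set)" by (simp add: additive_subgroup_def)
  note adjoint_P = adjoint_on_projection[OF assms] subgroup_UNIV subgroup_UNIV
  have diff: "P (x - y) = P x - P y" for x y using adjoint_on_apply_diff[OF adjoint_P] by simp
  show "additive_subgroup (range P)"
    unfolding additive_subgroup_def using adjoint_on_apply_zero[OF adjoint_P] by (auto simp flip: diff)
  show "additive_subgroup (kern P)"
    using adjoint_on_apply_zero[OF adjoint_P] by (simp add: additive_subgroup_def kern_def diff)
qed

lemma partial_isometry_on_adjoint: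
  assumes V: "adjoint_on ip M N V W" and M: "additive_subgroup M"
    and partial_isometry: "partial_isometry_on M V W"
  shows "partial_isometry_on N W V"
  unfolding partial_isometry_on_def
proof
  fix y assume "y \<in> N"
  note W = adjoint_on_sym[OF V]
  note maps = adjoint_on_in[OF V] adjoint_on_in[OF W]
  show "W (V (W y)) = W y"
  proof (rule eq_if_ip_eq[OF M])
    fix z assume "z \<in> M"
    then have "ip z (W (V (W y))) = ip (V (W (V z))) y"
      using \<open>y \<in> N\<close> by (simp add: maps adjoint_on_ip[OF V] adjoint_on_ip[OF W])
    also have "V (W (V z)) = V z"
      using partial_isometry \<open>z \<in> M\<close> by (simp add: partial_isometry_on_def)
    finally show "ip z (W (V (W y))) = ip z (W y)"
      using \<open>z \<in> M\<close> \<open>y \<in> N\<close> by (simp add: adjoint_on_ip[OF V])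
  qed (simp_all add: \<open>y \<in> N\<close> maps)
qed

lemma partial_isometry_on_isometry_iff:
  assumes V: "adjoint_on ip M N V W" and M: "additive_subgroup M" and N: "additive_subgroup N"
    and partial_isometry: "partial_isometry_on M V W"
  shows "(\<forall>x\<in>M. W (V x) = x) \<longleftrightarrow> sub_kern M V = {0}"
proof
  show "sub_kern M V = {0}" if "\<forall>x\<in>M. W (V x) = x"
    using that additive_subgroup_zero[OF M] adjoint_on_apply_zero[OF V M N]
      adjoint_on_apply_zero[OF adjoint_on_sym[OF V] N M]
    by (metis sub_kern_eq_zero_iff)
  assume kernel: "sub_kern M V = {0}"
  show "\<forall>x\<in>M. W (V x) = x"
  proof
    fix x assume x: "x \<in> M"
    then have WVx: "W (V x) \<in> M" by (intro adjoint_on_adj_in[OF V] adjoint_on_in[OF V])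
    have "V (W (V x) - x) = V (W (V x)) - V x"
      by (rule adjoint_on_apply_diff[OF V M N WVx x])
    then have "V (W (V x) - x) = 0"
      using partial_isometry x by (simp add: partial_isometry_on_def)
    then have "W (V x) - x = 0"
      by (rule sub_kern_trivialD[OF kernel additive_subgroup_diff[OF M WVx x]])
    then show "W (V x) = x" by simp
  qed
qed

lemma partial_isometry_on_unitary_iff:
  assumes V: "adjoint_on ip M N V W" and M: "additive_subgroup M" and N: "additive_subgroup N"
    and partial_isometry: "partial_isometry_on M V W"
  shows "unitary_on M N V W \<longleftrightarrow> sub_kern M V = {0} \<and> sub_kern N W = {0}"
  using partial_isometry_on_isometry_iff[OF V M N partial_isometry]
    partial_isometry_on_isometry_iff[OF adjoint_on_sym[OF V] N M
      partial_isometry_on_adjoint[OF V M partial_isometry]]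
  by (simp add: unitary_on_def)

end

section \<open>Block matrices of quasi-projection pairs\<close>

locale quasi_projection_block = hilbert_module scA st scH act ip
  for scA :: "complex \<Rightarrow> 'a::{real_normed_algebra,banach} \<Rightarrow> 'a"
    and st :: "'a \<Rightarrow> 'a"
    and scH :: "complex \<Rightarrow> 'h::ab_group_add \<Rightarrow> 'h"
    and act :: "'h \<Rightarrow> 'a \<Rightarrow> 'h"
    and ip :: "'h \<Rightarrow> 'h \<Rightarrow> 'a" +
  fixes M N :: "'h set" and A U Us Q0 :: "'h \<Rightarrow> 'h"
  assumes subgroup_M: "additive_subgroup M"
    and subgroup_N: "additive_subgroup N"
    and adjoint_A: "adjoint_on ip M M A A"
    and adjoint_U: "adjoint_on ip M N U Us"
    and partial_isometry_U: "partial_isometry_on M U Us"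
    and adjoint_Q0: "adjoint_on ip N N Q0 Q0"
    and Q0_idem: "y \<in> N \<Longrightarrow> Q0 (Q0 y) = Q0 y"
    and range_Us: "Us ` N = hclosure ip ((\<lambda>x. A (A x) - A x) ` M)"
    and Us_Q0: "y \<in> N \<Longrightarrow> Us (Q0 y) = 0"
begin

definition Q22 :: "'h \<Rightarrow> 'h" where
  "Q22 y = U (Us y - A (Us y)) + Q0 y"

abbreviation T :: "'h \<Rightarrow> 'h" where
  "T x \<equiv> A (A x) - A x"

lemmas adjoint_Us = adjoint_on_sym[OF adjoint_U]

lemmas zero_in_M = additive_subgroup_zero[OF subgroup_M]
  and zero_in_N = additive_subgroup_zero[OF subgroup_N]
  and A_zero = adjoint_on_apply_zero[OF adjoint_A subgroup_M subgroup_M]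
  and U_zero = adjoint_on_apply_zero[OF adjoint_U subgroup_M subgroup_N]
  and Us_zero = adjoint_on_apply_zero[OF adjoint_Us subgroup_N subgroup_M]
  and Q0_zero = adjoint_on_apply_zero[OF adjoint_Q0 subgroup_N subgroup_N]

lemmas A_in = adjoint_on_in[OF adjoint_A]
  and Us_in = adjoint_on_in[OF adjoint_Us]
  and Q0_in = adjoint_on_in[OF adjoint_Q0]

lemma sub_kern_T_trivial_iff:
  "sub_kern M T = {0} \<longleftrightarrow> sub_kern M A = {0} \<and> sub_kern M (\<lambda>x. x - A x) = {0}"
proof -
  have A_diff: "A (x - A x) = A x - A (A x)" if "x \<in> M" for x
    by (rule adjoint_on_apply_diff[OF adjoint_A subgroup_M subgroup_M that A_in[OF that]])
  then have "sub_kern M T = sub_kern M (\<lambda>x. A (x - A x))"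
    by (auto simp: sub_kern_def)
  also have "\<dots> = {0} \<longleftrightarrow> sub_kern M A = {0} \<and> sub_kern M (\<lambda>x. x - A x) = {0}"
  proof (rule sub_kern_comp_eq_zero_iff)
    show "x - A x \<in> M" if "x \<in> M" for x
      by (rule additive_subgroup_diff[OF subgroup_M that A_in[OF that]])
  qed (simp_all add: zero_in_M A_zero A_diff)
  finally show ?thesis .
qed

lemma sub_kern_U_eq: "sub_kern M U = sub_kern M T"
proof -
  have "adjoint_on ip M M T T"
    by (rule adjoint_on_diff[OF adjoint_on_comp[OF adjoint_A adjoint_A] adjoint_A
          subgroup_M subgroup_M])
  then have "sub_kern M T = M \<inter> orth ip (T ` M)"
    by (rule sub_kern_eq_orth_range_adjoint[OF _ subgroup_M subgroup_M])
  also have "orth ip (T ` M) = orth ip (Us ` N)"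
    by (simp only: range_Us orth_hclosure)
  also have "M \<inter> orth ip (Us ` N) = sub_kern M U"
    using sub_kern_eq_orth_range_adjoint[OF adjoint_U subgroup_M subgroup_N] by simp
  finally show ?thesis by simp
qed

lemma unitary_iff_sub_kern_T:
  "unitary_on M N U Us \<longleftrightarrow> sub_kern M T = {0} \<and> sub_kern N Us = {0}"
  using partial_isometry_on_unitary_iff[OF adjoint_U subgroup_M subgroup_N partial_isometry_U]
  by (simp only: sub_kern_U_eq)

lemma sub_kern_Q22_trivial_if_unitary:
  assumes "unitary_on M N U Us"
  shows "sub_kern N Q22 = {0} \<and> sub_kern N (\<lambda>y. y - Q22 y) = {0}"
proof -
  have kernels: "\<And>x. x \<in> M \<Longrightarrow> A x = 0 \<Longrightarrow> x = 0" "\<And>x. x \<in> M \<Longrightarrow> x - A x = 0 \<Longrightarrow> x = 0"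
      "\<And>y. y \<in> N \<Longrightarrow> Us y = 0 \<Longrightarrow> y = 0"
    using assms sub_kern_trivialD
    unfolding unitary_iff_sub_kern_T sub_kern_T_trivial_iff by blast+
  have Us_Q22: "Us (Q22 y) = Us y - A (Us y)" if "y \<in> N" for y
  proof -
    have "Q0 y = 0" using that Us_Q0 Q0_in kernels(3) by blast
    moreover have "Us y - A (Us y) \<in> M"
      using that by (intro additive_subgroup_diff[OF subgroup_M] A_in Us_in)
    ultimately show ?thesis using assms by (simp add: Q22_def unitary_on_def)
  qed
  have "y = 0" if "y \<in> N" "Q22 y = 0 \<or> y - Q22 y = 0" for y
  proof -
    have "Us y - A (Us y) = 0 \<or> A (Us y) = 0"
      using that Us_Q22[OF that(1)] Us_zero by auto
    then have "Us y = 0" using kernels(1,2) Us_in that(1) by blast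
    then show ?thesis using kernels(3) that(1) by blast
  qed
  moreover have "Q22 0 = 0" "0 - Q22 0 = 0" by (simp_all add: Q22_def A_zero U_zero Us_zero Q0_zero)
  ultimately show ?thesis
    using zero_in_N unfolding sub_kern_def by blast
qed

lemma sub_kern_Us_trivial_if_Q22:
  assumes "sub_kern N Q22 = {0}" "sub_kern N (\<lambda>y. y - Q22 y) = {0}"
  shows "sub_kern N Us = {0}"
proof -
  have Q22_eq: "Q22 y = Q0 y" if "Us y = 0" for y
    using that by (simp add: Q22_def A_zero U_zero)
  have "y = 0" if y: "y \<in> N" "Us y = 0" for y
  proof -
    have "Q22 (Q0 y) = Q0 y" using y by (simp add: Q22_eq Us_Q0 Q0_idem)
    then have "Q0 y = 0" using sub_kern_trivialD[OF assms(2) Q0_in[OF y(1)]] by simp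
    then have "Q22 y = 0" using Q22_eq[OF y(2)] by simp
    then show ?thesis by (rule sub_kern_trivialD[OF assms(1) y(1)])
  qed
  then show ?thesis using zero_in_N Us_zero unfolding sub_kern_def by blast
qed

lemma unitary_iff_sub_kern_Q22:
  "unitary_on M N U Us \<longleftrightarrow> sub_kern M A = {0} \<and> sub_kern M (\<lambda>x. x - A x) = {0} \<and>
    sub_kern N Q22 = {0} \<and> sub_kern N (\<lambda>y. y - Q22 y) = {0}"
  using sub_kern_Q22_trivial_if_unitary sub_kern_Us_trivial_if_Q22
    unitary_iff_sub_kern_T sub_kern_T_trivial_iff by argo

end

theorem theorem3p5:
  fixes scA :: "complex \<Rightarrow> 'a::{real_normed_algebra,banach} \<Rightarrow> 'a"
    and st :: "'a \<Rightarrow> 'a"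
    and scH :: "complex \<Rightarrow> 'h::ab_group_add \<Rightarrow> 'h"
    and act :: "'h \<Rightarrow> 'a \<Rightarrow> 'h"
    and ip :: "'h \<Rightarrow> 'h \<Rightarrow> 'a"
    and P Q A U Q0 :: "'h \<Rightarrow> 'h"
  assumes H: "hilbert_cstar_module scA st scH act ip"
    and PQ: "harmonious ip P Q"
    and nontriv: "P \<noteq> (\<lambda>x. 0)" "P \<noteq> id"
    and A_op: "adj_between ip (range P) (range P) A"
    and A_sa: "\<forall>x\<in>range P. \<forall>y\<in>range P. ip (A x) y = ip x (A y)"
    and A_pos: "op_pos ip (range P) (\<lambda>x. A (A x) - A x)"
    and U_op: "adj_between ip (range P) (kern P) U"
    and U_pi: "\<forall>x\<in>range P. U (adj_sub ip (range P) (kern P) U (U x)) = U x"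
    and Q0_op: "adj_between ip (kern P) (kern P) Q0"
    and Q0_proj: "\<forall>y\<in>kern P. Q0 (Q0 y) = Q0 y"
                 "\<forall>x\<in>kern P. \<forall>y\<in>kern P. ip (Q0 x) y = ip x (Q0 y)"
    and range_Ustar: "adj_sub ip (range P) (kern P) U ` kern P
                        = hclosure ip ((\<lambda>x. A (A x) - A x) ` range P)"
    and Ustar_Q0: "\<forall>y\<in>kern P. adj_sub ip (range P) (kern P) U (Q0 y) = 0"
    and block: "\<forall>u\<in>range P. \<forall>v\<in>kern P.
        P (Q (u + v)) = A u - ell ip (range P) A (adj_sub ip (range P) (kern P) U v) \<and>
        Q (u + v) - P (Q (u + v)) =
          U (ell ip (range P) A u)
          + (U (adj_sub ip (range P) (kern P) U v - A (adj_sub ip (range P) (kern P) U v)) + Q0 v)"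
  shows "let Us = adj_sub ip (range P) (kern P) U;
             Q22 = (\<lambda>y. U (Us y - A (Us y)) + Q0 y);
             c1 = (sub_kern (range P) A = {0} \<and> sub_kern (range P) (\<lambda>x. x - A x) = {0}
                   \<and> sub_kern (kern P) Us = {0});
             c2 = (sub_kern (range P) (\<lambda>x. A (A x) - A x) = {0} \<and> sub_kern (kern P) Us = {0});
             c3 = ((\<forall>x\<in>range P. Us (U x) = x) \<and> (\<forall>y\<in>kern P. U (Us y) = y));
             c4 = (sub_kern (range P) A = {0} \<and> sub_kern (range P) (\<lambda>x. x - A x) = {0}
                   \<and> sub_kern (kern P) Q22 = {0} \<and> sub_kern (kern P) (\<lambda>y. y - Q22 y) = {0})
         in (c1 \<longleftrightarrow> c2) \<and> (c2 \<longleftrightarrow> c3) \<and> (c3 \<longleftrightarrow> c4)"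
proof -
  interpret hilbert_module scA st scH act ip
  proof
    show "cstar_algebra scA st" using H unfolding hilbert_cstar_module_def by (rule conjunct1)
  qed (rule H)
  have P: "is_projection ip P"
    using PQ by (simp add: harmonious_def quasi_projection_pair_def)
  note subgroups = additive_subgroup_projection[OF P]
  let ?Us = "adj_sub ip (range P) (kern P) U"
  interpret quasi_projection_block scA st scH act ip "range P" "kern P" A U ?Us Q0
  proof
    show "adjoint_on ip (range P) (kern P) U ?Us"
      using U_op subgroups(1) by (rule adjoint_on_adj_sub)
    show "partial_isometry_on (range P) U ?Us"
      using U_pi by (simp add: partial_isometry_on_def)
    show "adjoint_on ip (range P) (range P) A A"
      using A_op A_sa by (simp add: adjoint_on_def adj_between_def)
    show "adjoint_on ip (kern P) (kern P) Q0 Q0"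
      using Q0_op Q0_proj(2) by (simp add: adjoint_on_def adj_between_def)
  qed (use subgroups Q0_proj(1) range_Ustar Ustar_Q0 in simp_all)
  show ?thesis
    using sub_kern_T_trivial_iff unitary_iff_sub_kern_T unitary_iff_sub_kern_Q22
    unfolding Let_def unitary_on_def Q22_def[abs_def] by argo
qed

end
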